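(* Let $A\in\mathbb{R}^{n\times n}$ ($n\ge 1$) be such that its directed graph $G=(V,E)$ is strongly connected, let $1\le K\le n$, and let $S\subset V$ with $|S|=k\le K$. Then $S\in\tilde{\mathcal{C}}_K$ if and only if $|\bar m(S)|\ge n-K+k$, where $\bar m(S)$ is a maximum matching in the bipartite graph $\mathcal{H}_b(S)$.
   Context: $V=\{v_1,\dots,v_n\}$; $(v_j,v_i)\in E$ exactly when $A_{ij}\neq0$. For $S\subset V$, $B(S)\in\mathbb{R}^{n\times n}$ is the diagonal matrix with $i$th diagonal entry $1$ if $v_i\in S$ and $0$ otherwise. A pair $(\hat A,\hat B)$ of real $n\times n$ matrices is controllable if $[\hat B\ \hat A\hat B\cdots\hat A^{n-1}\hat B]$ has rank $n$. $(A,B(S))$ is structurally controllable if there is a controllable pair of real $n\times n$ matrices $(\hat A,\hat B)$ such that $[\hat A\ \hat B]$ and $[A\ B(S)]$ have zeros at exactly the same entries. $\mathcal{C}_K=\{S\subset V:|S|=K,\ (A,B(S))\text{ is structurally controllable}\}$ and $\tilde{\mathcal C}_K=\{\Omega:\exists S\in\mathcal C_K\text{ such that }\Omega\subset S\}$. Auxiliary bipartite graph $\mathcal{H}_b(S)$ (undirected): let $V'=\{v_1',\dots,v_n'\}$ and $V''=\{v_1'',\dots,v_n''\}$ be two disjoint copies of $V$, and $S''\subset V''$ the copy of $S$. The two vertex classes are $V\cup S''$ and $V'$. There is an edge between $v_i\in V$ and $v_j'$ whenever $(v_i,v_j)\in E$, and an edge between $v_k''$ and $v_k'$ whenever $v_k\in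 S$; there are no other edges. A matching is a set of edges no two of which share a vertex; a maximum matching is one with the largest cardinality. *)

theory Defs
  imports
    "Jordan_Normal_Form.DL_Rank"
    "Graph_Theory.Pair_Digraph"
    "Graph_Theory.Digraph_Component"
begin

(* The vertices v_1, ..., v_n are represented by the 0-based matrix indices 0, ..., n - 1,
   where n = dim_row A. *)

definition digraph_of :: "real mat \<Rightarrow> nat pair_pre_digraph" where
  "digraph_of A =
     \<lparr> pverts = {..<dim_row A},
       parcs = {(j, i). i < dim_row A \<and> j < dim_row A \<and> A $$ (i, j) \<noteq> 0} \<rparr>"

definition input_mat :: "nat \<Rightarrow> nat set \<Rightarrow> real mat" where
  "input_mat n S = mat_diag n (\<lambda>i. if i \<in> S then 1 else 0)"

(* The block row [M_0 M_1 ... ] of matrices that all have n rows. *)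
definition block_row :: "nat \<Rightarrow> real mat list \<Rightarrow> real mat" where
  "block_row n Ms = mat_of_cols n (concat (map cols Ms))"

definition controllable :: "nat \<Rightarrow> real mat \<Rightarrow> real mat \<Rightarrow> bool" where
  "controllable n A B \<longleftrightarrow>
     vec_space.rank n (block_row n (map (\<lambda>i. (A ^\<^sub>m i) * B) [0..<n])) = n"

definition same_zero_pattern :: "real mat \<Rightarrow> real mat \<Rightarrow> bool" where
  "same_zero_pattern M N \<longleftrightarrow>
     dim_row M = dim_row N \<and> dim_col M = dim_col N \<and>
     (\<forall>i < dim_row M. \<forall>j < dim_col M. M $$ (i, j) = 0 \<longleftrightarrow> N $$ (i, j) = 0)"

definition structurally_controllable :: "nat \<Rightarrow> real mat \<Rightarrow> real mat \<Rightarrow> bool" where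
  "structurally_controllable n A B \<longleftrightarrow>
     (\<exists>A' \<in> carrier_mat n n. \<exists>B' \<in> carrier_mat n n.
        controllable n A' B' \<and>
        same_zero_pattern (block_row n [A', B']) (block_row n [A, B]))"

definition control_sets :: "real mat \<Rightarrow> nat \<Rightarrow> nat set set" where
  "control_sets A K =
     {S. S \<subseteq> {..<dim_row A} \<and> card S = K \<and>
         structurally_controllable (dim_row A) A (input_mat (dim_row A) S)}"

definition extendable_sets :: "real mat \<Rightarrow> nat \<Rightarrow> nat set set" where
  "extendable_sets A K = {\<Omega>. \<exists>S \<in> control_sets A K. \<Omega> \<subseteq> S}"

(* Orig i, Copy1 i and Copy2 i stand for v_i, v_i' and v_i''. *)
datatype bvertex = Orig nat | Copy1 nat | Copy2 nat

(* An undirected bipartite graph; an edge is the set of its two endpoints. *)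
record 'a bigraph =
  left_class :: "'a set"
  right_class :: "'a set"
  bedges :: "'a set set"

definition aux_bigraph :: "real mat \<Rightarrow> nat set \<Rightarrow> bvertex bigraph" where
  "aux_bigraph A S =
     \<lparr> left_class = Orig ` pverts (digraph_of A) \<union> Copy2 ` S,
       right_class = Copy1 ` pverts (digraph_of A),
       bedges = {{Orig i, Copy1 j} | i j. (i, j) \<in> parcs (digraph_of A)}
              \<union> {{Copy2 k, Copy1 k} | k. k \<in> S} \<rparr>"

definition matching :: "'a bigraph \<Rightarrow> 'a set set \<Rightarrow> bool" where
  "matching H M \<longleftrightarrow>
     M \<subseteq> bedges H \<and> (\<forall>e \<in> M. \<forall>f \<in> M. e \<noteq> f \<longrightarrow> e \<inter> f = {})"

definition maximum_matching :: "'a bigraph \<Rightarrow> 'a set set \<Rightarrow> bool" where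
  "maximum_matching H M \<longleftrightarrow>
     finite M \<and> matching H M \<and> (\<forall>M'. matching H M' \<longrightarrow> finite M' \<and> card M' \<le> card M)"

lemma finite_aux_bigraph_edges:
  assumes "S \<subseteq> {..<dim_row A}"
  shows "finite (bedges (aux_bigraph A S))"
proof (rule finite_subset)
  let ?V = "Orig ` {..<dim_row A} \<union> Copy1 ` {..<dim_row A} \<union> Copy2 ` {..<dim_row A}"
  show "bedges (aux_bigraph A S) \<subseteq> Pow ?V"
    using assms by (auto simp: aux_bigraph_def digraph_of_def)
  show "finite (Pow ?V)" by simp
qed

lemma maximum_matching_exists:
  assumes "S \<subseteq> {..<dim_row A}"
  shows "\<exists>M. maximum_matching (aux_bigraph A S) M"
proof -
  let ?H = "aux_bigraph A S"
  have fin: "finite M \<and> card M \<le> card (bedges ?H)" if "matching ?H M" for M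
    using that finite_aux_bigraph_edges[OF assms]
    by (auto simp: matching_def intro: finite_subset card_mono)
  have "matching ?H {}"
    by (simp add: matching_def)
  then obtain M where "matching ?H M" "\<And>M'. matching ?H M' \<Longrightarrow> card M' \<le> card M"
    using ex_has_greatest_nat[of "matching ?H" "{}" card "Suc (card (bedges ?H))"] fin
    by (auto simp: less_Suc_eq_le)
  with fin show ?thesis
    by (auto simp: maximum_matching_def)
qed

end

theory Submission
  imports
    Defs
    "HOL-Computational_Algebra.Polynomial_FPS"
    "HOL-Computational_Algebra.Field_as_Ring"
    "HOL-Combinatorics.Cycles"
begin

text \<open>
  The proposition reduces to a criterion for strongly connected graphs
  (\<open>structurally_controllable_iff\<close>): for nonempty \<open>T\<close>, the pair \<open>(A, B(T))\<close> is structurally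
  controllable if and only if every vertex \<open>i\<close> outside \<open>T\<close> can be assigned an in-neighbour
  \<open>p i\<close> such that \<open>p\<close> is injective.  Granted this, a set \<open>T \<supseteq> S\<close> with \<open>K\<close> elements and such
  a map \<open>p\<close> give a matching with \<open>n - K\<close> edges from \<open>p\<close> and \<open>k\<close> edges from \<open>S\<close>.  Conversely, a
  matching with at least \<open>n - K + k\<close> edges leaves at most \<open>K - k\<close> of the vertices \<open>Copy1 j\<close>
  uncovered; adding their indices to \<open>S\<close> and filling up to \<open>K\<close> elements yields
  \<open>T\<close>, and the matching edges at the other vertices yield \<open>p\<close>.

  Necessity in the criterion is linear algebra.  If \<open>(A', B')\<close> is controllable, then \<open>[A' B']\<close> has
  independent rows; the rows of \<open>A'\<close> outside \<open>T\<close> are then independent, and independent rows admit an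
  injective choice of nonzero entries (\<open>independent_rows_choose_nonzero_entries\<close>).

  For sufficiency one has to produce real weights.  The map \<open>p\<close> splits the vertices into chains
  rooted in \<open>T\<close> and cycles.  The chains alone are controllable from \<open>T\<close>.  By strong connectivity the
  cycles can be attached one at a time, each through a single edge from the part built so far;
  \<open>attach_cycle\<close> shows that controllability persists when the cycle weight \<open>s\<close> avoids finitely many
  values, because the modes of the cycle correspond to the roots of \<open>1 - s\<^sup>l X\<^sup>l\<close> and
  the transfer function from the
  inputs to the attaching vertex is a nonzero rational function.  The weights obtained in this way are
  zero on some edges.  Controllability is an open condition, so a small perturbation gives the exact
  zero pattern of \<open>A\<close> (\<open>detects_perturb_to_full_support\<close>).

  The construction works with the dual condition \<open>detects\<close>, that no nonzero row vector annihilates the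
  columns of all \<open>A\<^sup>k B\<close>.  This is linear algebra on plain functions over a growing vertex set; it
  is translated into matrix rank only at the end.
\<close>

section \<open>Nonzero transversals of independent rows\<close>

text \<open>
  A Hall-type theorem without determinants.  Besides producing the matching from a controllable
  pair, its contrapositive is the only source of linear dependence used below: more rows than
  columns leave no room for an injection.  For the induction, the row \<open>r0\<close> needs a column \<open>c\<close>
  with nonzero entry whose deletion keeps the other rows independent.  If every such \<open>c\<close> failed,
  each unit vector \<open>e\<^sub>c\<close> in the support of row \<open>r0\<close> would lie in the span of the other rows, and
  hence so would row \<open>r0\<close> itself.
\<close>
lemma independent_rows_choose_nonzero_entries:
  fixes a :: "'r \<Rightarrow> 'c \<Rightarrow> 'k::field"
  assumes "finite R" "finite C"
    and "\<And>x. (\<And>c. c \<in> C \<Longrightarrow> (\<Sum>r\<in>R. x r * a r c) = 0) \<Longrightarrow> \<forall>r\<in>R. x r = 0"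
  shows "\<exists>p. inj_on p R \<and> (\<forall>r\<in>R. p r \<in> C \<and> a r (p r) \<noteq> 0)"
  using assms
proof (induction R arbitrary: C rule: finite_induct)
  case empty
  then show ?case by auto
next
  case (insert r0 R)
  note fin = insert.hyps(1) insert.prems(1)
  have indep: "\<forall>r\<in>R. x r = 0" if "\<And>c. c \<in> C \<Longrightarrow> (\<Sum>r\<in>R. x r * a r c) = 0" for x
  proof -
    have eq: "(\<Sum>r\<in>insert r0 R. (if r = r0 then 0 else x r) * a r c) = (\<Sum>r\<in>R. x r * a r c)" for c
      using insert.hyps by (auto intro!: sum.cong)
    have "\<forall>r\<in>insert r0 R. (if r = r0 then 0 else x r) = 0"
      by (rule insert.prems(2)) (use eq that in auto)
    with insert.hyps(2) show ?thesis by (metis insertCI)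
  qed
  have "\<exists>c\<in>C. a r0 c \<noteq> 0 \<and>
      (\<forall>x. (\<forall>c'\<in>C - {c}. (\<Sum>r\<in>R. x r * a r c') = 0) \<longrightarrow> (\<forall>r\<in>R. x r = 0))"
  proof (rule ccontr)
    define C' where "C' = {c \<in> C. a r0 c \<noteq> 0}"
    assume "\<not> ?thesis"
    then have "\<forall>c\<in>C'. \<exists>x. (\<forall>c'\<in>C - {c}. (\<Sum>r\<in>R. x r * a r c') = 0) \<and> (\<exists>r\<in>R. x r \<noteq> 0)"
      by (auto simp: C'_def)
    then obtain y where y0: "\<And>c c'. c \<in> C' \<Longrightarrow> c' \<in> C - {c} \<Longrightarrow> (\<Sum>r\<in>R. y c r * a r c') = 0"
      and yn: "\<And>c. c \<in> C' \<Longrightarrow> \<exists>r\<in>R. y c r \<noteq> 0"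
      by metis
    \<comment> \<open>the combination \<open>y c\<close> of the rows in \<open>R\<close> equals \<open>s c\<close> times the unit vector of column \<open>c\<close>\<close>
    define s where "s c = (\<Sum>r\<in>R. y c r * a r c)" for c
    have s: "s c \<noteq> 0" if "c \<in> C'" for c
    proof
      assume "s c = 0"
      then have "(\<Sum>r\<in>R. y c r * a r c') = 0" if "c' \<in> C" for c'
        using y0[OF \<open>c \<in> C'\<close>, of c'] that by (cases "c' = c") (auto simp: s_def)
      from indep[OF this] yn[OF that] show False by auto
    qed
    define x where "x r = (if r = r0 then -1 else \<Sum>c\<in>C'. a r0 c / s c * y c r)" for r
    have fC': "finite C'" using fin by (simp add: C'_def)
    have "(\<Sum>r\<in>insert r0 R. x r * a r c) = 0" if "c \<in> C" for c
    proof -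
      have "(\<Sum>r\<in>R. x r * a r c) = (\<Sum>r\<in>R. \<Sum>d\<in>C'. a r0 d / s d * (y d r * a r c))"
        using insert.hyps by (auto simp: x_def sum_distrib_right mult.assoc intro!: sum.cong)
      also have "\<dots> = (\<Sum>d\<in>C'. a r0 d / s d * (\<Sum>r\<in>R. y d r * a r c))"
        by (subst sum.swap) (simp add: sum_distrib_left)
      also have "\<dots> = (\<Sum>d\<in>C'. if d = c then a r0 c else 0)"
        using y0 s that by (intro sum.cong) (auto simp: s_def)
      also have "\<dots> = a r0 c"
        using fC' that by (auto simp: C'_def)
      finally show ?thesis using insert.hyps by (simp add: x_def)
    qed
    from insert.prems(2)[OF this] show False by (auto simp: x_def)
  qed
  then obtain c where c: "c \<in> C" "a r0 c \<noteq> 0"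
    and ind: "\<And>x. (\<And>c'. c' \<in> C - {c} \<Longrightarrow> (\<Sum>r\<in>R. x r * a r c') = 0) \<Longrightarrow> \<forall>r\<in>R. x r = 0"
    by blast
  obtain p where p: "inj_on p R" "\<forall>r\<in>R. p r \<in> C - {c} \<and> a r (p r) \<noteq> 0"
    using insert.IH[OF _ ind] fin by blast
  have "inj_on (p(r0 := c)) (insert r0 R)"
    using p insert.hyps(2) by (auto simp: inj_on_def)
  moreover have "\<forall>r\<in>insert r0 R. (p(r0 := c)) r \<in> C \<and> a r ((p(r0 := c)) r) \<noteq> 0"
    using p c by auto
  ultimately show ?case by blast
qed

section \<open>Detection by the powers of a weight matrix\<close>

definition row_act :: "'v set \<Rightarrow> ('v \<Rightarrow> 'v \<Rightarrow> real) \<Rightarrow> ('v \<Rightarrow> real) \<Rightarrow> 'v \<Rightarrow> real" where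
  "row_act V a x j = (\<Sum>i\<in>V. x i * a i j)"

text \<open>
  Controllability in dual form: no nonzero row vector \<open>x\<close> is annihilated by the columns \<open>t \<in> T\<close>
  of all powers of \<open>a\<close>.  The weights are functions on an arbitrary vertex set so that the
  set may grow during the construction.
\<close>
definition detects :: "'v set \<Rightarrow> ('v \<Rightarrow> 'v \<Rightarrow> real) \<Rightarrow> 'v set \<Rightarrow> bool" where
  "detects V a T \<longleftrightarrow>
     (\<forall>x. (\<forall>k. \<forall>t\<in>T. (row_act V a ^^ k) x t = 0) \<longrightarrow> (\<forall>i\<in>V. x i = 0))"

lemma row_act_power_Suc:
  "(row_act V a ^^ Suc k) x j = (\<Sum>i\<in>V. (row_act V a ^^ k) x i * a i j)"
  by (simp add: row_act_def)

lemma row_act_power_cong: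
  assumes "\<And>i. i \<in> V \<Longrightarrow> x i = y i" "j \<in> V"
  shows "(row_act V a ^^ k) x j = (row_act V a ^^ k) y j"
  using assms(2)
proof (induction k arbitrary: j)
  case (Suc k)
  then show ?case by (simp add: row_act_def)
qed (use assms in auto)

lemma row_act_power_linear:
  assumes "finite I"
  shows "(row_act V a ^^ k) (\<lambda>j. \<Sum>i\<in>I. c i * f i j) = (\<lambda>j. \<Sum>i\<in>I. c i * (row_act V a ^^ k) (f i) j)"
proof (induction k)
  case (Suc k)
  show ?case
  proof
    fix j
    have "(row_act V a ^^ Suc k) (\<lambda>j. \<Sum>i\<in>I. c i * f i j) j
        = (\<Sum>v\<in>V. \<Sum>i\<in>I. c i * ((row_act V a ^^ k) (f i) v * a v j))"
      unfolding row_act_power_Suc Suc by (simp add: sum_distrib_right mult.assoc)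
    also have "\<dots> = (\<Sum>i\<in>I. c i * (\<Sum>v\<in>V. (row_act V a ^^ k) (f i) v * a v j))"
      by (subst sum.swap) (simp add: sum_distrib_left)
    also have "\<dots> = (\<Sum>i\<in>I. c i * (row_act V a ^^ Suc k) (f i) j)"
      unfolding row_act_power_Suc ..
    finally show "(row_act V a ^^ Suc k) (\<lambda>j. \<Sum>i\<in>I. c i * f i j) j = \<dots>" .
  qed
qed simp

lemma row_act_power_unit_expansion:
  assumes "finite V" "j \<in> V"
  shows "(row_act V a ^^ k) x j = (\<Sum>i\<in>V. x i * (row_act V a ^^ k) (\<lambda>v. of_bool (v = i)) j)"
proof -
  have "(row_act V a ^^ k) x j = (row_act V a ^^ k) (\<lambda>v. \<Sum>i\<in>V. x i * of_bool (v = i)) j"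
  proof (rule row_act_power_cong[OF _ assms(2)])
    fix v assume "v \<in> V"
    then show "x v = (\<Sum>i\<in>V. x i * of_bool (v = i))"
      using assms by (simp add: of_bool_def if_distrib cong: if_cong)
  qed
  then show ?thesis by (simp add: row_act_power_linear[OF assms(1)])
qed

text \<open>
  The \<open>card V + 1\<close> vectors \<open>A\<^sup>j e\<^sub>t\<close> with \<open>j \<le> card V\<close> are linearly dependent, which gives one
  linear recurrence for all observation sequences at \<open>t\<close>, independently of the starting vector.
  Choosing \<open>J\<close> as the last nonzero coefficient lets the recurrence be solved for its top term.
\<close>
lemma row_act_power_recurrence:
  assumes fin: "finite V" and t: "t \<in> V"
  shows "\<exists>p J. J \<le> card V \<and> p J \<noteq> 0 \<and>
           (\<forall>x k. (\<Sum>j\<le>J. p j * (row_act V a ^^ (k + j)) x t) = 0)"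
proof -
  let ?b = "\<lambda>k i. (row_act V a ^^ k) (\<lambda>v. of_bool (v = i)) t"
  have "\<exists>p. (\<forall>i\<in>V. (\<Sum>j\<le>card V. p j * ?b j i) = 0) \<and> (\<exists>j\<le>card V. p j \<noteq> 0)"
  proof (rule ccontr)
    assume "\<not> ?thesis"
    then have "\<exists>q. inj_on q {..card V} \<and> (\<forall>j\<in>{..card V}. q j \<in> V \<and> ?b j (q j) \<noteq> 0)"
      by (intro independent_rows_choose_nonzero_entries[OF _ fin]) auto
    then obtain q where "inj_on q {..card V}" "q ` {..card V} \<subseteq> V" by blast
    from card_inj_on_le[OF this fin] show False by simp
  qed
  then obtain p where p0: "\<And>i. i \<in> V \<Longrightarrow> (\<Sum>j\<le>card V. p j * ?b j i) = 0"
    and pn: "\<exists>j\<le>card V. p j \<noteq> 0" by blast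
  define J where "J = Max {j. j \<le> card V \<and> p j \<noteq> 0}"
  have "J \<in> {j. j \<le> card V \<and> p j \<noteq> 0}"
    unfolding J_def by (rule Max_in) (use pn in auto)
  then have J: "J \<le> card V" "p J \<noteq> 0" by auto
  have "p j = 0" if "J < j" "j \<le> card V" for j
    using Max_ge[of "{j. j \<le> card V \<and> p j \<noteq> 0}" j] that by (fastforce simp: J_def)
  then have trunc: "(\<Sum>j\<le>J. p j * f j) = (\<Sum>j\<le>card V. p j * f j)" for f
    using J by (intro sum.mono_neutral_left) auto
  have "(\<Sum>j\<le>J. p j * (row_act V a ^^ (k + j)) x t) = 0" for x k
  proof -
    define y where "y = (row_act V a ^^ k) x"
    have "(row_act V a ^^ (k + j)) x t = (\<Sum>i\<in>V. y i * ?b j i)" for j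
      unfolding y_def row_act_power_unit_expansion[OF fin t, symmetric]
      by (simp add: funpow_add add.commute[of k])
    then have "(\<Sum>j\<le>J. p j * (row_act V a ^^ (k + j)) x t)
        = (\<Sum>j\<le>card V. \<Sum>i\<in>V. y i * (p j * ?b j i))"
      unfolding trunc by (simp add: sum_distrib_left mult.left_commute)
    also have "\<dots> = (\<Sum>i\<in>V. y i * (\<Sum>j\<le>card V. p j * ?b j i))"
      by (subst sum.swap) (simp add: sum_distrib_left)
    finally show ?thesis by (simp add: p0)
  qed
  with J show ?thesis by blast
qed

text \<open>
  By the recurrence, the first \<open>card V\<close> observations determine all later ones.
\<close>
lemma detects_finite_horizon:
  assumes "finite V" "T \<subseteq> V" "detects V a T"
    and "\<And>k t. k < card V \<Longrightarrow> t \<in> T \<Longrightarrow> (row_act V a ^^ k) x t = 0" and "i \<in> V"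
  shows "x i = 0"
proof -
  have "(row_act V a ^^ k) x t = 0" if t: "t \<in> T" for k t
  proof -
    obtain p J where J: "J \<le> card V" "p J \<noteq> 0"
      and rec: "\<And>k. (\<Sum>j\<le>J. p j * (row_act V a ^^ (k + j)) x t) = 0"
      using row_act_power_recurrence[OF assms(1), of t a] t assms(2) by blast
    show ?thesis
    proof (induction k rule: less_induct)
      case (less k)
      show ?case
      proof (cases "k < card V")
        case False
        have "(\<Sum>j\<le>J. p j * (row_act V a ^^ (k - J + j)) x t)
            = (\<Sum>j\<le>J. if j = J then p J * (row_act V a ^^ k) x t else 0)"
          using less False J(1) by (intro sum.cong) auto
        then show ?thesis using rec[of "k - J"] J(2) by simp
      qed (use assms(4) t in auto)
    qed
  qed
  with assms(3,5) show ?thesis unfolding detects_def by blast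
qed

section \<open>Attaching a cycle\<close>

text \<open>
  The generating functions of the observations at \<open>t\<close> are rational with a common denominator,
  namely the reversal of the recurrence polynomial.
\<close>
lemma row_act_generating_function_rational:
  assumes fin: "finite V" and t: "t \<in> V"
  shows "\<exists>P. P \<noteq> 0 \<and>
           (\<forall>x. \<exists>Q. fps_of_poly P * Abs_fps (\<lambda>k. (row_act V a ^^ k) x t) = fps_of_poly Q)"
proof -
  obtain p J where J: "p J \<noteq> 0"
    and rec: "\<And>x k. (\<Sum>j\<le>J. p j * (row_act V a ^^ (k + j)) x t) = 0"
    using row_act_power_recurrence[OF fin t, of a] by blast
  define P where "P = (\<Sum>j\<le>J. monom (p j) (J - j))"
  have coeff_P: "coeff P m = (if m \<le> J then p (J - m) else 0)" for m
  proof -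
    have "coeff P m = (\<Sum>j\<le>J. if J - j = m then p j else 0)"
      by (simp add: P_def coeff_sum)
    also have "\<dots> = (\<Sum>j\<le>J. if j = J - m then (if m \<le> J then p (J - m) else 0) else 0)"
      by (intro sum.cong) auto
    finally show ?thesis by simp
  qed
  have "coeff P 0 \<noteq> 0" using J by (simp add: coeff_P)
  then have "P \<noteq> 0" by auto
  moreover have "\<exists>Q. fps_of_poly P * Abs_fps (\<lambda>k. (row_act V a ^^ k) x t) = fps_of_poly Q" for x
  proof -
    let ?g = "\<lambda>k. (row_act V a ^^ k) x t"
    let ?F = "fps_of_poly P * Abs_fps ?g"
    have "fps_nth ?F m = 0" if "m \<ge> J" for m
    proof -
      have "fps_nth ?F m = (\<Sum>i=0..m. coeff P i * ?g (m - i))"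
        by (simp add: fps_mult_nth)
      also have "\<dots> = (\<Sum>i\<le>J. p (J - i) * ?g (m - i))"
        using that by (intro sum.mono_neutral_cong_right) (auto simp: coeff_P)
      also have "\<dots> = (\<Sum>j\<le>J. p j * ?g (m - J + j))"
        using that by (intro sum.reindex_bij_witness[of _ "\<lambda>j. J - j" "\<lambda>j. J - j"]) auto
      finally show ?thesis using rec by simp
    qed
    then have "?F = fps_of_poly (\<Sum>m<J. monom (fps_nth ?F m) m)"
      by (intro fps_ext) (simp add: coeff_sum)
    then show ?thesis by blast
  qed
  ultimately show ?thesis by blast
qed

text \<open>
  For different \<open>s > 0\<close> the polynomials \<open>1 - s\<^sup>l X\<^sup>l\<close> are pairwise coprime, and \<open>Q\<close> has only
  finitely many prime factors to share with them.
\<close>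
lemma exists_coprime_one_minus_monom:
  fixes Q :: "real poly"
  assumes "Q \<noteq> 0" "l > 0"
  shows "\<exists>s. s \<noteq> 0 \<and> coprime Q (1 - monom (s ^ l) l)"
proof (rule ccontr)
  assume "\<not> ?thesis"
  have "\<exists>q. prime q \<and> q dvd Q \<and> q dvd 1 - monom (s ^ l) l" if "s \<in> {0<..}" for s :: real
  proof -
    from \<open>\<not> (\<exists>s. s \<noteq> 0 \<and> coprime Q (1 - monom (s ^ l) l))\<close> that
    obtain d where d: "d dvd Q" "d dvd 1 - monom (s ^ l) l" "\<not> is_unit d"
      unfolding coprime_def by (metis greaterThan_iff less_irrefl)
    then have "d \<noteq> 0" using assms(1) by auto
    with d(3) obtain q where "prime q" "q dvd d" by (metis prime_divisor_exists)
    with d show ?thesis by (meson dvd_trans)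
  qed
  then obtain f where f: "\<And>s. s \<in> {0<..} \<Longrightarrow> prime (f s) \<and> f s dvd Q \<and> f s dvd 1 - monom (s ^ l) l"
    by metis
  have "f ` {0<..} \<subseteq> prime_factors Q"
    using f assms(1) by (auto simp: in_prime_factors_iff)
  then have "finite (f ` {0<..})" by (rule finite_subset) simp
  moreover have "infinite ({0<..} :: real set)" by (rule infinite_Ioi)
  moreover have "inj_on f {0<..}"
  proof (rule inj_onI, rule ccontr)
    fix s r :: real
    assume sr: "s \<in> {0<..}" "r \<in> {0<..}" "f s = f r" "s \<noteq> r"
    then have ne: "r ^ l - s ^ l \<noteq> 0" using assms(2) by (simp add: power_eq_iff_eq_base)
    have "f s dvd (1 - monom (s ^ l) l) - (1 - monom (r ^ l) l)"
      using f[OF sr(1)] f[OF sr(2)] sr(3) by (metis dvd_diff)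
    also have "\<dots> = monom (r ^ l - s ^ l) l" by (simp add: diff_monom)
    finally have "f s dvd smult (s ^ l) (smult (inverse (r ^ l - s ^ l)) (monom (r ^ l - s ^ l) l))"
      by (intro dvd_smult)
    then have "f s dvd monom (s ^ l) l" using ne by (simp add: smult_monom)
    then have "f s dvd (1 - monom (s ^ l) l) + monom (s ^ l) l"
      using f[OF sr(1)] by (metis dvd_add)
    then have "is_unit (f s)" by simp
    with f[OF sr(1)] show False by auto
  qed
  ultimately show False using finite_imageD by blast
qed

text \<open>
  The central step.  A cycle \<open>C\<close>, run through by \<open>\<sigma>\<close>, is joined to a detecting part \<open>D\<close> by one
  edge from \<open>u \<in> D\<close> to \<open>w \<in> C\<close>; all edges of the cycle carry the same weight \<open>s\<close>.  Suppose \<open>z\<close> is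
  annihilated, and fix \<open>t \<in> T\<close> at which the unit vector at \<open>u\<close> is observed.
  Let \<open>c k\<close> be the value at \<open>w\<close> after \<open>k\<close> steps, so that \<open>c (k + l) = s\<^sup>l c k\<close>, let
  \<open>H\<close> be the generating function of the observations of that unit vector at \<open>t\<close>, and let \<open>G\<close> be
  the one for \<open>z\<close> restricted to \<open>D\<close>.  In step \<open>k\<close> the row action adds \<open>c k\<close> at \<open>u\<close>, hence
  \<open>G + X (\<Sum>k. c k X\<^sup>k) H = 0\<close>.  Multiplying by the common denominator \<open>P\<close> of \<open>G\<close> and \<open>H\<close> and by
  \<open>1 - s\<^sup>l X\<^sup>l\<close> turns every factor into a polynomial: with \<open>Q = P H\<close> and
  \<open>Y = (\<Sum>k<l. c k X\<^sup>k)\<close>, the polynomial \<open>1 - s\<^sup>l X\<^sup>l\<close> divides \<open>X Q Y\<close>.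
  Now \<open>Q\<close> is nonzero because \<open>D\<close> detects the unit vector at \<open>u\<close>, and it does not depend on
  \<open>s\<close>; for suitable \<open>s\<close> it is coprime to \<open>1 - s\<^sup>l X\<^sup>l\<close>, and then \<open>Y = 0\<close> by degree.  So \<open>z\<close>
  vanishes on the cycle, and therefore on \<open>D\<close> as well.

  The number \<open>l\<close> may be any positive period of \<open>w\<close>, not only the length of the cycle.
\<close>
lemma attach_cycle:
  fixes D C T :: "'v set"
  assumes fin: "finite D" "finite C" and disj: "D \<inter> C = {}"
    and T: "T \<subseteq> D" and det: "detects D a T"
    and u: "u \<in> D" and l: "l > 0" and cyc: "(\<sigma> ^^ l) w = w"
    and C: "C = range (\<lambda>k. (\<sigma> ^^ k) w)"
  defines "glue \<equiv> \<lambda>s i j. if i \<in> D then of_bool (j \<in> D) * a i j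
             else s * of_bool (j \<in> C \<and> i = \<sigma> j) + of_bool (i = w \<and> j = u)"
  shows "\<exists>s. detects (D \<union> C) (glue s) T"
proof -
  let ?L = "row_act D a" and ?e = "\<lambda>v. of_bool (v = u) :: real"
  have "\<not> (\<forall>k. \<forall>t\<in>T. (?L ^^ k) ?e t = 0)"
    
  proof
    assume "\<forall>k. \<forall>t\<in>T. (?L ^^ k) ?e t = 0"
    then have "\<forall>i\<in>D. ?e i = 0" using det unfolding detects_def by blast
    with u show False by auto
  qed
  then obtain k0 t where t: "t \<in> T" "(?L ^^ k0) ?e t \<noteq> 0" by blast
  with T have tD: "t \<in> D" by blast
  obtain P where P: "P \<noteq> 0"
    and rat: "\<And>x. \<exists>Q. fps_of_poly P * Abs_fps (\<lambda>k. (?L ^^ k) x t) = fps_of_poly Q"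
    using row_act_generating_function_rational[OF fin(1) tD, of a] by blast
  define H where "H = Abs_fps (\<lambda>k. (?L ^^ k) ?e t)"
  obtain Q where Q: "fps_of_poly P * H = fps_of_poly Q" using rat unfolding H_def by blast
  have "fps_nth H k0 \<noteq> 0" using t by (simp add: H_def)
  then have "H \<noteq> 0" by auto
  with P Q have "Q \<noteq> 0" by auto
  then obtain s where s: "s \<noteq> 0" and cop: "coprime Q (1 - monom (s ^ l) l)"
    using exists_coprime_one_minus_monom l by blast
  let ?M = "row_act (D \<union> C) (glue s)"
  have \<sigma>C: "\<sigma> j \<in> C" if "j \<in> C" for j
  proof -
    from that C obtain k where "j = (\<sigma> ^^ k) w" by auto
    then have "\<sigma> j = (\<sigma> ^^ Suc k) w" by simp
    then show ?thesis unfolding C by blast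
  qed
  have w: "w \<in> C" unfolding C by (rule range_eqI[of _ _ 0]) simp
  have split: "?M z j = (\<Sum>i\<in>D. z i * glue s i j) + (\<Sum>i\<in>C. z i * glue s i j)" for z j
    unfolding row_act_def using fin disj by (simp add: sum.union_disjoint)
  have onC: "?M z j = s * z (\<sigma> j)" if "j \<in> C" for z j
  proof -
    have "(\<Sum>i\<in>D. z i * glue s i j) = 0"
      using that disj by (intro sum.neutral) (auto simp: glue_def)
    moreover have "(\<Sum>i\<in>C. z i * glue s i j) = (\<Sum>i\<in>C. if i = \<sigma> j then s * z i else 0)"
      using that disj u by (intro sum.cong) (auto simp: glue_def)
    ultimately show ?thesis using \<sigma>C[OF that] fin by (simp add: split)
  qed
  have onD: "?M z j = ?L z j + of_bool (j = u) * z w" if "j \<in> D" for z j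
  proof -
    have "(\<Sum>i\<in>D. z i * glue s i j) = ?L z j"
      using that unfolding row_act_def by (intro sum.cong) (auto simp: glue_def)
    moreover have "(\<Sum>i\<in>C. z i * glue s i j) = (\<Sum>i\<in>C. if i = w then of_bool (j = u) * z i else 0)"
      using that disj by (intro sum.cong) (auto simp: glue_def)
    ultimately show ?thesis using w fin by (simp add: split)
  qed
  have "z i = 0" if ann: "\<And>k t. t \<in> T \<Longrightarrow> (?M ^^ k) z t = 0" and i: "i \<in> D \<union> C" for z i
  proof -
    define c where "c k = s ^ k * z ((\<sigma> ^^ k) w)" for k
    have powC: "(?M ^^ k) z j = s ^ k * z ((\<sigma> ^^ k) j)" if "j \<in> C" for k j
      using that
    proof (induction k arbitrary: j)
      case (Suc k)
      then show ?case using onC[of j "(?M ^^ k) z"] \<sigma>C[of j] by (simp add: funpow_swap1)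
    qed simp
    \<comment> \<open>superposition of the initial values on \<open>D\<close> and
       the impulses \<open>c i\<close> that reach \<open>u\<close> at time \<open>i + 1\<close>\<close>
    have powD: "(?M ^^ k) z j = (?L ^^ k) z j + (\<Sum>i<k. c i * (?L ^^ (k - 1 - i)) ?e j)"
      if "j \<in> D" for k j
      using that
    proof (induction k arbitrary: j)
      case (Suc k)
      have "(?M ^^ Suc k) z j = ?L ((?M ^^ k) z) j + of_bool (j = u) * c k"
        using onD[OF Suc.prems, of "(?M ^^ k) z"] powC[OF w] by (simp add: c_def)
      also have "?L ((?M ^^ k) z) j
          = (\<Sum>v\<in>D. ((?L ^^ k) z v + (\<Sum>i<k. c i * (?L ^^ (k - 1 - i)) ?e v)) * a v j)"
        unfolding row_act_def[of D a "(?M ^^ k) z"] using Suc.IH by (intro sum.cong) auto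
      also have "\<dots> = (?L ^^ Suc k) z j
          + (\<Sum>v\<in>D. \<Sum>i<k. c i * ((?L ^^ (k - 1 - i)) ?e v * a v j))"
        unfolding row_act_power_Suc by (simp add: distrib_right sum.distrib sum_distrib_right mult.assoc)
      also have "(\<Sum>v\<in>D. \<Sum>i<k. c i * ((?L ^^ (k - 1 - i)) ?e v * a v j))
          = (\<Sum>i<k. c i * (?L ^^ Suc (k - 1 - i)) ?e j)"
        unfolding row_act_power_Suc by (subst sum.swap) (simp add: sum_distrib_left)
      also have "\<dots> = (\<Sum>i<k. c i * (?L ^^ (Suc k - 1 - i)) ?e j)"
        by (intro sum.cong) (auto simp: Suc_diff_Suc simp del: funpow.simps)
      finally show ?case by simp
    qed simp
    define G where "G = Abs_fps (\<lambda>k. (?L ^^ k) z t)"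
    define Cs where "Cs = Abs_fps c"
    have eq: "G + fps_X * (Cs * H) = 0"
    proof (rule fps_ext)
      fix k
      show "fps_nth (G + fps_X * (Cs * H)) k = fps_nth 0 k"
      proof (cases k)
        case 0
        then show ?thesis using ann[OF t(1), of 0] by (simp add: G_def)
      next
        case (Suc m)
        have "fps_nth (Cs * H) m = (\<Sum>i<k. c i * (?L ^^ (k - 1 - i)) ?e t)"
          unfolding fps_mult_nth Suc by (intro sum.cong) (auto simp: Cs_def H_def)
        then show ?thesis
          using ann[OF t(1), of k] powD[OF tD, of k] Suc by (simp add: G_def)
      qed
    qed
    have per: "(\<sigma> ^^ (k mod l)) w = (\<sigma> ^^ k) w" for k
      by (rule funpow_mod_eq[OF cyc])
    \<comment> \<open>the periodicity of \<open>c\<close> up to the factor \<open>s\<^sup>l\<close> makes \<open>Cs\<close> rational as well\<close>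
    define Y where "Y = (\<Sum>k<l. monom (c k) k)"
    have coeff_Y: "coeff Y k = (if k < l then c k else 0)" for k
      by (simp add: Y_def coeff_sum)
    let ?B = "1 - monom (s ^ l) l"
    have Y: "Cs * fps_of_poly ?B = fps_of_poly Y"
    proof (rule fps_ext)
      fix k
      have "fps_of_poly ?B = 1 - fps_const (s ^ l) * fps_X ^ l"
        by (simp add: fps_of_poly_diff fps_of_poly_monom)
      then have "Cs * fps_of_poly ?B = Cs - fps_const (s ^ l) * (Cs * fps_X ^ l)"
        by (simp only: right_diff_distrib mult_1_right mult.left_commute)
      then have "fps_nth (Cs * fps_of_poly ?B) k = c k - s ^ l * (if k < l then 0 else c (k - l))"
        by (simp add: Cs_def fps_X_power_mult_right_nth)
      also have "\<dots> = coeff Y k"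
      proof (cases "k < l")
        case False
        have "(\<sigma> ^^ k) w = (\<sigma> ^^ (k - l)) w"
          using per[of k] per[of "k - l"] False by (metis le_mod_geq not_less)
        moreover have "s ^ k = s ^ l * s ^ (k - l)"
          using False by (simp flip: power_add)
        ultimately show ?thesis using False by (simp add: coeff_Y c_def)
      qed (simp add: coeff_Y)
      finally show "fps_nth (Cs * fps_of_poly ?B) k = fps_nth (fps_of_poly Y) k" by simp
    qed
    obtain R where R: "fps_of_poly P * G = fps_of_poly R" using rat unfolding G_def by blast
    have "fps_of_poly (R * ?B + monom 1 1 * (Q * Y))
        = (fps_of_poly P * G) * fps_of_poly ?B
          + fps_X * ((fps_of_poly P * H) * (Cs * fps_of_poly ?B))"
      unfolding R Q Y fps_of_poly_add fps_of_poly_mult by (simp add: fps_of_poly_monom)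
    also have "\<dots> = fps_of_poly P * fps_of_poly ?B * (G + fps_X * (Cs * H))"
      by (simp only: distrib_left distrib_right mult.assoc mult.commute mult.left_commute)
    also have "\<dots> = fps_of_poly 0" unfolding eq by simp
    finally have "R * ?B + monom 1 1 * (Q * Y) = 0" by (simp only: fps_of_poly_eq_iff)
    then have "monom 1 1 * (Q * Y) = ?B * (- R)" by (simp add: algebra_simps add_eq_0_iff)
    then have "?B dvd Q * (monom 1 1 * Y)" by (metis dvd_triv_left mult.left_commute)
    with cop have "?B dvd monom 1 1 * Y" by (metis coprime_commute coprime_dvd_mult_right_iff)
    moreover have "coprime ?B (monom 1 1)"
    proof (rule coprimeI)
      fix d :: "real poly" assume d: "d dvd ?B" "d dvd monom 1 1"
      have "monom (s ^ l) l = monom 1 1 * monom (s ^ l) (l - 1)"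
        using l by (simp add: mult_monom)
      with d(2) have "d dvd monom (s ^ l) l" by simp
      with d(1) have "d dvd ?B + monom (s ^ l) l" by (rule dvd_add)
      then show "is_unit d" by simp
    qed
    ultimately have "?B dvd Y" by (metis coprime_dvd_mult_right_iff)
    moreover have "degree Y < l" using l coeff_Y by (intro degree_lessI) auto
    moreover have "degree ?B \<ge> l"
      by (rule le_degree) (use s l in simp)
    ultimately have "Y = 0" by (metis dvd_imp_degree_le le_trans not_le)
    then have "c k = 0" if "k < l" for k using coeff_Y[of k] that by simp
    then have zC: "z ((\<sigma> ^^ k) w) = 0" for k
      using per[of k] s l by (metis c_def mod_less_divisor mult_eq_0_iff power_not_zero)
    then have "c k = 0" for k by (simp add: c_def)
    then have "(?L ^^ k) z t' = 0" if "t' \<in> T" for k t'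
      using ann[OF that, of k] powD[of t' k] that T by auto
    then have "\<forall>i\<in>D. z i = 0" using det unfolding detects_def by blast
    with zC i show ?thesis unfolding C by blast
  qed
  then show ?thesis unfolding detects_def by blast
qed

section \<open>Detecting weights on a strongly connected support\<close>

text \<open>
  The vertices from which iterating \<open>p\<close> leads into \<open>T\<close>.  If \<open>p\<close> maps \<open>V - T\<close> injectively into
  a finite set \<open>V\<close>, they form disjoint chains rooted in \<open>T\<close>, and \<open>p\<close> permutes the remaining vertices.
\<close>
inductive_set chain_to :: "'v set \<Rightarrow> ('v \<Rightarrow> 'v) \<Rightarrow> 'v set \<Rightarrow> 'v set" for V p T where
  start: "t \<in> T \<Longrightarrow> t \<in> chain_to V p T"
| step: "i \<in> V - T \<Longrightarrow> p i \<in> chain_to V p T \<Longrightarrow> i \<in> chain_to V p T"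

text \<open>
  Injectivity means that the vertex \<open>p i\<close> passes its signal to \<open>i\<close> alone, so the value at \<open>i\<close> is
  observed at \<open>p i\<close> one step later, and finally in \<open>T\<close>.
\<close>
lemma chains_detected:
  assumes "finite V" "T \<subseteq> V" "inj_on p (V - T)"
  defines "D \<equiv> chain_to V p T"
  shows "detects D (\<lambda>i j. of_bool (i \<notin> T \<and> j = p i)) T"
  unfolding detects_def
proof (intro allI impI ballI)
  have DV: "D \<subseteq> V"
  proof
    fix i assume "i \<in> D"
    then show "i \<in> V" unfolding D_def by induction (use assms(2) in auto)
  qed
  then have finD: "finite D" using assms(1) finite_subset by blast
  let ?L = "row_act D (\<lambda>i j. of_bool (i \<notin> T \<and> j = p i))"
  fix x i
  assume ann: "\<forall>k. \<forall>t\<in>T. (?L ^^ k) x t = 0" and i: "i \<in> D"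
  have "(?L ^^ k) x i = 0" for k
    using i unfolding D_def
  proof (induction arbitrary: k)
    case (step i)
    have iD: "i \<in> D" using step.hyps unfolding D_def by (rule chain_to.step)
    have "(?L ^^ Suc k) x (p i) = (\<Sum>v\<in>D. if v = i then (?L ^^ k) x i else 0)"
      unfolding row_act_power_Suc
      using step.hyps(1) DV assms(3) by (intro sum.cong) (auto simp: inj_on_def)
    also have "\<dots> = (?L ^^ k) x i" using finD iD by simp
    finally show ?case using step.IH[of "Suc k"] by (simp only: D_def)
  qed (use ann D_def in auto)
  from this[of 0] show "x i = 0" by simp
qed

text \<open>
  Start from the chains rooted in \<open>T\<close> and attach cycles of \<open>p\<close> one after the other.  Strong
  connectivity enters through \<open>conn\<close>: as long as vertices are missing, some edge leads from the
  part \<open>D\<close> reached so far to a vertex \<open>w\<close> outside, and the whole \<open>p\<close>-cycle of \<open>w\<close> is outside, since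
  \<open>D\<close> is a union of chains and cycles.
\<close>
lemma exists_detecting_weights:
  fixes V T :: "'v set" and edge :: "'v \<Rightarrow> 'v \<Rightarrow> bool"
  assumes fin: "finite V" and T: "T \<subseteq> V" "T \<noteq> {}"
    and inj: "inj_on p (V - T)"
    and p: "\<And>i. i \<in> V - T \<Longrightarrow> p i \<in> V \<and> edge i (p i)"
    and conn: "\<And>D. D \<subset> V \<Longrightarrow> D \<noteq> {} \<Longrightarrow> \<exists>u\<in>D. \<exists>w\<in>V - D. edge w u"
  shows "\<exists>a. detects V a T \<and> (\<forall>i\<in>V. \<forall>j\<in>V. a i j \<noteq> 0 \<longrightarrow> edge i j)"
proof -
  have grow: "\<exists>a. detects V a T \<and> (\<forall>i\<in>V. \<forall>j\<in>V. a i j \<noteq> 0 \<longrightarrow> edge i j)"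
    if "T \<subseteq> D" "D \<subseteq> V" "detects D a T" "\<forall>i\<in>D. \<forall>j\<in>D. a i j \<noteq> 0 \<longrightarrow> edge i j"
      and "\<And>i. i \<in> V - T \<Longrightarrow> p i \<in> D \<longleftrightarrow> i \<in> D" for D a
    using that
  proof (induction "card (V - D)" arbitrary: D a rule: less_induct)
    case less
    note TD = less.prems(1) and DV = less.prems(2) and closed = less.prems(5)
    show ?case
    proof (cases "D = V")
      case True
      with less.prems show ?thesis by blast
    next
      case False
      with DV TD T(2) obtain u w where u: "u \<in> D" and w: "w \<in> V - D" and uw: "edge w u"
        using conn[of D] by blast
      define U where "U = V - D"
      have pU: "p i \<in> U" if "i \<in> U" for i
        using that closed p TD unfolding U_def by blast
      have injU: "inj_on p U" using inj by (rule inj_on_subset) (use TD in \<open>auto simp: U_def\<close>)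
      have finU: "finite U" using fin by (simp add: U_def)
      \<comment> \<open>extended by the identity, \<open>p\<close> becomes a permutation;
         its inverse is the map that runs through the cycles\<close>
      define q where "q i = (if i \<in> U then p i else i)" for i
      have "bij_betw p U U"
        using injU finU pU by (simp add: bij_betw_def endo_inj_surj image_subsetI)
      then have "bij_betw q U U" by (simp add: q_def cong: bij_betw_cong)
      then have perm: "q permutes U" by (rule bij_imp_permutes) (simp add: q_def)
      define \<sigma> where "\<sigma> = inv_into UNIV q"
      have perm': "\<sigma> permutes U" unfolding \<sigma>_def using perm by (rule permutes_inv)
      have q\<sigma>: "q (\<sigma> i) = i" "\<sigma> (q i) = i" for i
        unfolding \<sigma>_def using permutes_inverses[OF perm] by auto
      obtain l where l: "l > 0" "\<sigma> ^^ l = id"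
        using permutation_is_nilpotent permutes_imp_permutation[OF finU perm'] by metis
      have cyc: "(\<sigma> ^^ l) w = w" by (simp add: l(2))
      define C where "C = range (\<lambda>k. (\<sigma> ^^ k) w)"
      have CU: "C \<subseteq> U"
      proof -
        have "(\<sigma> ^^ k) w \<in> U" for k
          by (induction k) (use w permutes_in_image[OF perm'] in \<open>auto simp: U_def\<close>)
        then show ?thesis by (auto simp: C_def)
      qed
      then have disj: "D \<inter> C = {}" by (auto simp: U_def)
      have wC: "w \<in> C" unfolding C_def by (rule range_eqI[of _ _ 0]) simp
      have \<sigma>C: "\<sigma> i \<in> C" if iC: "i \<in> C" for i
      proof -
        obtain k where "i = (\<sigma> ^^ k) w" using iC unfolding C_def by blast
        then have "\<sigma> i = (\<sigma> ^^ Suc k) w" by simp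
        then show ?thesis unfolding C_def by blast
      qed
      have qC: "q i \<in> C" if iC: "i \<in> C" for i
      proof -
        obtain k where k: "i = (\<sigma> ^^ k) w" using iC unfolding C_def by blast
        have "i = (\<sigma> ^^ (k + l)) w" using k cyc by (simp add: funpow_add)
        then have "i = \<sigma> ((\<sigma> ^^ (k + l - 1)) w)"
          using l(1) by (metis Suc_diff_1 add_gr_0 comp_apply funpow.simps(2))
        then have "q i = (\<sigma> ^^ (k + l - 1)) w" by (simp add: q\<sigma>)
        then show ?thesis unfolding C_def by blast
      qed
      have finC: "finite C" using CU finU finite_subset by blast
      define glue where "glue s i j = (if i \<in> D then of_bool (j \<in> D) * a i j
             else s * of_bool (j \<in> C \<and> i = \<sigma> j) + of_bool (i = w \<and> j = u))" for s i j
      obtain s where s: "detects (D \<union> C) (glue s) T"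
        using attach_cycle[OF _ finC disj TD less.prems(3) u l(1) cyc C_def]
          finite_subset[OF DV fin] unfolding glue_def by blast
      show ?thesis
      proof (rule less.hyps[OF _ _ _ s])
        show "card (V - (D \<union> C)) < card (V - D)"
          using w wC DV fin by (intro psubset_card_mono) auto
        show "T \<subseteq> D \<union> C" "D \<union> C \<subseteq> V" using TD DV CU by (auto simp: U_def)
        show "\<forall>i\<in>D \<union> C. \<forall>j\<in>D \<union> C. glue s i j \<noteq> 0 \<longrightarrow> edge i j"
        proof (intro ballI impI)
          fix i j assume ij: "i \<in> D \<union> C" "j \<in> D \<union> C" "glue s i j \<noteq> 0"
          consider "i \<in> D" "j \<in> D" "a i j \<noteq> 0" | "j \<in> C" "i = \<sigma> j" | "i = w" "j = u"
            using ij(3) by (cases "i \<in> D") (auto simp: glue_def of_bool_def split: if_splits)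
          then show "edge i j"
          proof cases
            case 2
            then have "i \<in> U" using \<sigma>C CU by blast
            moreover from this have "p i = j" using 2 q\<sigma>(1)[of j] by (simp add: q_def)
            ultimately show ?thesis using p[of i] TD by (auto simp: U_def)
          qed (use less.prems(4) uw in auto)
        qed
        fix i assume i: "i \<in> V - T"
        show "p i \<in> D \<union> C \<longleftrightarrow> i \<in> D \<union> C"
        proof (cases "i \<in> D")
          case True
          with closed[OF i] show ?thesis by simp
        next
          case False
          with i have iU: "i \<in> U" by (simp add: U_def)
          then have "p i = q i" by (simp add: q_def)
          with qC[of i] \<sigma>C[of "q i"] q\<sigma>(2)[of i] closed[OF i] False show ?thesis by auto
        qed
      qed
    qed
  qed
  let ?D = "chain_to V p T" and ?a = "\<lambda>i j. of_bool (i \<notin> T \<and> j = p i) :: real"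
  have sub: "?D \<subseteq> V"
  proof
    fix i assume "i \<in> ?D"
    then show "i \<in> V" by induction (use T in auto)
  qed
  show ?thesis
  proof (rule grow[of ?D ?a])
    show "T \<subseteq> ?D" by (auto intro: chain_to.start)
    show "detects ?D ?a T" by (rule chains_detected[OF fin T(1) inj])
    show "\<forall>i\<in>?D. \<forall>j\<in>?D. ?a i j \<noteq> 0 \<longrightarrow> edge i j" using p sub by auto
    show "p i \<in> ?D \<longleftrightarrow> i \<in> ?D" if "i \<in> V - T" for i
      using that by (auto intro: chain_to.step elim: chain_to.cases)
  qed (rule sub)
qed

section \<open>Perturbation to full support\<close>

text \<open>
  Gram matrices turn the triviality of a common annihilator into the nonvanishing of one
  determinant, because the quadratic form of the matrix is a sum of squares.
\<close>
lemma det_gram_nonzero_iff: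
  fixes f :: "nat \<Rightarrow> 'q \<Rightarrow> real"
  assumes fin: "finite I"
  shows "det (mat n n (\<lambda>(i, j). \<Sum>q\<in>I. f i q * f j q)) \<noteq> 0 \<longleftrightarrow>
    (\<forall>x. (\<forall>q\<in>I. (\<Sum>i<n. x i * f i q) = 0) \<longrightarrow> (\<forall>i<n. x i = 0))"
proof -
  define W where "W = mat n n (\<lambda>(i, j). \<Sum>q\<in>I. f i q * f j q)"
  have W: "W \<in> carrier_mat n n" by (simp add: W_def)
  define g where "g x q = (\<Sum>i<n. x i * f i q)" for x q
  have mult: "(W *\<^sub>v vec n x) $ i = (\<Sum>q\<in>I. f i q * g x q)" if "i < n" for x i
  proof -
    have "(W *\<^sub>v vec n x) $ i = (\<Sum>j<n. \<Sum>q\<in>I. f i q * (x j * f j q))"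
      using that by (simp add: W_def scalar_prod_def atLeast0LessThan sum_distrib_left sum_distrib_right mult_ac)
    then show ?thesis by (subst (asm) sum.swap) (simp add: g_def sum_distrib_left)
  qed
  have quad: "(\<Sum>i<n. x i * (W *\<^sub>v vec n x) $ i) = (\<Sum>q\<in>I. (g x q)\<^sup>2)" for x
  proof -
    have "(\<Sum>i<n. x i * (W *\<^sub>v vec n x) $ i) = (\<Sum>i<n. \<Sum>q\<in>I. x i * f i q * g x q)"
      using mult by (simp add: sum_distrib_left mult.assoc)
    also have "\<dots> = (\<Sum>q\<in>I. g x q * g x q)"
      by (subst sum.swap) (simp add: g_def[of x] sum_distrib_right)
    finally show ?thesis by (simp add: power2_eq_square)
  qed
  have "(\<forall>q\<in>I. g x q = 0) \<longleftrightarrow> W *\<^sub>v vec n x = 0\<^sub>v n" for x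
  proof
    assume "\<forall>q\<in>I. g x q = 0"
    then show "W *\<^sub>v vec n x = 0\<^sub>v n" using W mult by (intro eq_vecI) auto
  next
    assume "W *\<^sub>v vec n x = 0\<^sub>v n"
    with quad[of x] have "(\<Sum>q\<in>I. (g x q)\<^sup>2) = 0" by simp
    then show "\<forall>q\<in>I. g x q = 0" using fin by (simp add: sum_nonneg_eq_0_iff)
  qed
  moreover have "vec n x = 0\<^sub>v n \<longleftrightarrow> (\<forall>i<n. x i = 0)" for x :: "nat \<Rightarrow> real"
    by (auto simp: vec_eq_iff)
  moreover have "det W \<noteq> 0 \<longleftrightarrow> (\<forall>x. W *\<^sub>v vec n x = 0\<^sub>v n \<longrightarrow> vec n x = 0\<^sub>v n)"
    unfolding det_0_iff_vec_prod_zero_field[OF W] by (metis eq_vecI vec_carrier carrier_vecD dim_vec index_vec)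
  ultimately show ?thesis unfolding W_def[symmetric] g_def[symmetric] by simp
qed

text \<open>
  Detection is an open condition: it says that a Gram determinant is nonzero, and this determinant
  is continuous in the weights.  Moving a little in the direction \<open>b\<close> makes all entries in the
  support of \<open>b\<close> nonzero without destroying detection.
\<close>
lemma detects_perturb_to_full_support:
  fixes a b :: "nat \<Rightarrow> nat \<Rightarrow> real"
  assumes T: "T \<subseteq> {..<n}" and det: "detects {..<n} a T"
    and supp: "\<And>i j. i < n \<Longrightarrow> j < n \<Longrightarrow> a i j \<noteq> 0 \<Longrightarrow> b i j \<noteq> 0"
  shows "\<exists>a'. detects {..<n} a' T \<and> (\<forall>i<n. \<forall>j<n. a' i j = 0 \<longleftrightarrow> b i j = 0)"
proof -
  define c where "c \<epsilon> i j = a i j + \<epsilon> * b i j" for \<epsilon> i j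
  let ?L = "\<lambda>\<epsilon>. row_act {..<n} (c \<epsilon>)"
  define f where "f \<epsilon> i q = (?L \<epsilon> ^^ fst q) (\<lambda>v. of_bool (v = i)) (snd q)" for \<epsilon> i and q :: "nat \<times> nat"
  define W where "W \<epsilon> = mat n n (\<lambda>(i, j). \<Sum>q\<in>{..<n} \<times> T. f \<epsilon> i q * f \<epsilon> j q)" for \<epsilon>
  have W: "W \<epsilon> \<in> carrier_mat n n" for \<epsilon> by (simp add: W_def)
  have finT: "finite T" using T finite_subset by blast
  have f: "(\<Sum>i<n. x i * f \<epsilon> i q) = (?L \<epsilon> ^^ fst q) x (snd q)" if "q \<in> {..<n} \<times> T" for x \<epsilon> q
    using that T unfolding f_def by (subst row_act_power_unit_expansion[of _ _ _ _ x]) auto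
  have detects_iff: "detects {..<n} (c \<epsilon>) T \<longleftrightarrow> det (W \<epsilon>) \<noteq> 0" for \<epsilon>
  proof -
    have "detects {..<n} (c \<epsilon>) T \<longleftrightarrow>
        (\<forall>x. (\<forall>q\<in>{..<n} \<times> T. (?L \<epsilon> ^^ fst q) x (snd q) = 0) \<longrightarrow> (\<forall>i<n. x i = 0))"
    proof
      assume "detects {..<n} (c \<epsilon>) T"
      from detects_finite_horizon[OF _ T this]
      show "\<forall>x. (\<forall>q\<in>{..<n} \<times> T. (?L \<epsilon> ^^ fst q) x (snd q) = 0) \<longrightarrow> (\<forall>i<n. x i = 0)"
        by force
    next
      assume *: "\<forall>x. (\<forall>q\<in>{..<n} \<times> T. (?L \<epsilon> ^^ fst q) x (snd q) = 0) \<longrightarrow> (\<forall>i<n. x i = 0)"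
      show "detects {..<n} (c \<epsilon>) T" unfolding detects_def
      proof (intro allI impI ballI)
        fix x i assume "\<forall>k. \<forall>t\<in>T. (?L \<epsilon> ^^ k) x t = 0" "i \<in> {..<n}"
        with * show "x i = 0" by auto
      qed
    qed
    also have "\<dots> \<longleftrightarrow> det (W \<epsilon>) \<noteq> 0"
      unfolding W_def det_gram_nonzero_iff[OF finite_cartesian_product[OF finite_lessThan finT]]
      by (simp only: f cong: ball_cong)
    finally show ?thesis .
  qed
  have "c 0 = a" by (simp add: c_def fun_eq_iff)
  with detects_iff[of 0] det have W0: "det (W 0) \<noteq> 0" by simp
  have cont: "isCont (\<lambda>\<epsilon>. (?L \<epsilon> ^^ k) x j) 0" for k x j
  proof (induction k arbitrary: j)
    case (Suc k)
    then show ?case unfolding row_act_power_Suc c_def by (intro continuous_intros)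
  qed simp
  have "isCont (\<lambda>\<epsilon>. det (W \<epsilon>)) 0"
  proof -
    have "isCont (\<lambda>\<epsilon>. W \<epsilon> $$ (i, j)) 0" if "i < n" "j < n" for i j
      using that by (simp add: W_def f_def) (intro continuous_intros cont)
    then have "isCont (\<lambda>\<epsilon>. \<Sum>p\<in>{p. p permutes {0..<n}}. signof p * (\<Prod>i = 0..<n. W \<epsilon> $$ (i, p i))) 0"
      by (intro continuous_intros) (auto dest: permutes_in_image)
    then show ?thesis by (simp only: det_def'[OF W])
  qed
  then have ev_det: "\<forall>\<^sub>F \<epsilon> in at 0. det (W \<epsilon>) \<noteq> 0"
    using W0 unfolding isCont_def by (rule tendsto_imp_eventually_ne)
  have "\<forall>\<^sub>F \<epsilon> in at 0. c \<epsilon> i j = 0 \<longleftrightarrow> b i j = 0" if "i < n" "j < n" for i j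
  proof (cases "a i j = 0")
    case True
    have "\<forall>\<^sub>F \<epsilon> in at (0::real). \<epsilon> \<noteq> 0" by (simp add: eventually_at_filter)
    then show ?thesis by eventually_elim (simp add: c_def True)
  next
    case False
    have "((\<lambda>\<epsilon>. c \<epsilon> i j) \<longlongrightarrow> a i j) (at 0)"
      unfolding c_def by (auto intro!: tendsto_eq_intros)
    then have "\<forall>\<^sub>F \<epsilon> in at 0. c \<epsilon> i j \<noteq> 0" using False by (rule tendsto_imp_eventually_ne)
    then show ?thesis using supp[OF that False] by (auto elim: eventually_mono)
  qed
  then have ev_supp: "\<forall>\<^sub>F \<epsilon> in at 0. \<forall>i\<in>{..<n}. \<forall>j\<in>{..<n}. c \<epsilon> i j = 0 \<longleftrightarrow> b i j = 0"
    by (auto simp: eventually_ball_finite_distrib)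
  obtain \<epsilon> where \<epsilon>: "det (W \<epsilon>) \<noteq> 0" "\<forall>i\<in>{..<n}. \<forall>j\<in>{..<n}. c \<epsilon> i j = 0 \<longleftrightarrow> b i j = 0"
    using eventually_happens[OF eventually_conj[OF ev_det ev_supp]] by auto
  from \<epsilon>(1) have "detects {..<n} (c \<epsilon>) T" by (simp add: detects_iff)
  with \<epsilon>(2) show ?thesis by auto
qed

section \<open>Controllability as triviality of an annihilator\<close>

lemma (in vec_space) orthogonal_to_span:
  assumes S: "S \<subseteq> carrier_vec n" and x: "x \<in> carrier_vec n"
    and orth: "\<And>v. v \<in> S \<Longrightarrow> v \<bullet> x = 0" and v: "v \<in> span S"
  shows "v \<bullet> x = 0"
proof -
  have "submodule class_ring {v \<in> carrier_vec n. v \<bullet> x = 0} V"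
    by (rule submodule.intro) (use x module_axioms in \<open>auto simp: add_scalar_prod_distrib[of _ n]\<close>)
  then have "span S \<subseteq> {v \<in> carrier_vec n. v \<bullet> x = 0}"
    by (rule span_is_subset[rotated]) (use S orth in auto)
  with v show ?thesis by auto
qed

text \<open>
  Compare with a maximal independent set \<open>U\<close> of columns, which spans all of them: if it has fewer
  than \<open>n\<close> elements, some nonzero vector is orthogonal to it; if it has \<open>n\<close> elements, it is a
  basis and a vector orthogonal to it is orthogonal to itself.
\<close>
lemma rank_eq_dim_iff:
  fixes M :: "real mat"
  assumes M: "M \<in> carrier_mat n m"
  shows "vec_space.rank n M = n \<longleftrightarrow>
    (\<forall>x\<in>carrier_vec n. (\<forall>v\<in>set (cols M). v \<bullet> x = 0) \<longrightarrow> x = 0\<^sub>v n)"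
proof -
  interpret vec_space "TYPE(real)" n .
  have cols: "set (cols M) \<subseteq> carrier_vec n" using cols_dim[of M] M by auto
  obtain U where U: "maximal U (\<lambda>T. T \<subseteq> set (cols M) \<and> lin_indpt T)" "finite U"
  proof -
    have "\<exists>A. finite A \<and> maximal A (\<lambda>T. T \<subseteq> set (cols M) \<and> lin_indpt T) \<and> {} \<subseteq> A"
      by (rule maximal_exists_superset[of "set (cols M)"]) (auto simp: lin_dep_def)
    with that show thesis by blast
  qed
  have UM: "U \<subseteq> set (cols M)" and li: "lin_indpt U" using U(1) by (auto simp: maximal_def)
  then have Uc: "U \<subseteq> carrier_vec n" using cols by blast
  have rank: "rank M = card U" by (rule rank_card_indpt[OF M U(1)])
  have colsU: "v \<in> span U" if v: "v \<in> set (cols M)" for v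
  proof (cases "v \<in> U")
    case True
    then show ?thesis using in_own_span[of U] Uc by auto
  next
    case False
    then have "lin_dep (U \<union> {v})" using U(1) UM v unfolding maximal_def by (metis Un_empty_right Un_insert_right insertI1 insert_subset subset_insertI)
    then show ?thesis using lin_dep_iff_in_span[of U v] Uc li cols v False by auto
  qed
  have "card U = n" if ann: "\<And>x. x \<in> carrier_vec n \<Longrightarrow> (\<forall>v\<in>set (cols M). v \<bullet> x = 0) \<Longrightarrow> x = 0\<^sub>v n"
  proof (rule ccontr)
    assume "card U \<noteq> n"
    moreover have "card U \<le> n" using li_le_dim(2)[OF fin_dim] Uc li dim_is_n by simp
    ultimately have less: "card U < n" by simp
    have "\<exists>y. (\<forall>v\<in>U. (\<Sum>i\<in>{..<n}. y i * v $ i) = 0) \<and> (\<exists>i<n. y i \<noteq> 0)"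
    proof (rule ccontr)
      assume "\<not> ?thesis"
      then have "\<exists>p. inj_on p {..<n} \<and> (\<forall>i\<in>{..<n}. p i \<in> U \<and> p i $ i \<noteq> 0)"
        by (intro independent_rows_choose_nonzero_entries[OF _ U(2), of "{..<n}" "\<lambda>i v. v $ i"]) auto
      then obtain p where "inj_on p {..<n}" "p ` {..<n} \<subseteq> U" by blast
      from card_inj_on_le[OF this U(2)] less show False by simp
    qed
    then obtain y i0 where y: "\<And>v. v \<in> U \<Longrightarrow> (\<Sum>i\<in>{..<n}. y i * v $ i) = 0" "i0 < n" "y i0 \<noteq> 0"
      by blast
    define x where "x = vec n y"
    have x: "x \<in> carrier_vec n" "x \<noteq> 0\<^sub>v n"
      using y(2,3) by (auto simp: x_def dest!: arg_cong[of _ _ "\<lambda>v. v $ i0"])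
    have "v \<bullet> x = 0" if "v \<in> U" for v
      using y(1)[OF that] by (simp add: x_def scalar_prod_def atLeast0LessThan mult.commute)
    then have "\<forall>v\<in>set (cols M). v \<bullet> x = 0"
      using orthogonal_to_span[OF Uc x(1)] colsU by blast
    with ann x show False by blast
  qed
  moreover have "x = 0\<^sub>v n"
    if n: "card U = n" and x: "x \<in> carrier_vec n" "\<forall>v\<in>set (cols M). v \<bullet> x = 0" for x
  proof -
    have "basis U" using dim_li_is_basis[OF fin_dim U(2)] Uc li n dim_is_n by simp
    then have "x \<in> span U" using x by (simp add: basis_def)
    then have "x \<bullet> x = 0" using orthogonal_to_span[OF Uc x(1)] x(2) UM by blast
    then have "x \<bullet>c x = 0" by simp
    then show ?thesis using conjugate_square_eq_0_vec[OF x(1)] by simp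
  qed
  ultimately show ?thesis unfolding rank by blast
qed

lemma block_row_carrier_cols:
  assumes "\<And>M. M \<in> set Ms \<Longrightarrow> dim_row M = n"
  shows "block_row n Ms \<in> carrier_mat n (sum_list (map dim_col Ms))"
    and "set (cols (block_row n Ms)) = (\<Union>M\<in>set Ms. set (cols M))"
proof -
  have "length (concat (map cols Ms)) = sum_list (map dim_col Ms)"
    by (simp add: length_concat comp_def)
  then show "block_row n Ms \<in> carrier_mat n (sum_list (map dim_col Ms))"
    by (metis block_row_def mat_of_cols_carrier(1))
  have "set (concat (map cols Ms)) \<subseteq> carrier_vec n"
  proof
    fix v assume "v \<in> set (concat (map cols Ms))"
    then obtain M where "M \<in> set Ms" "v \<in> set (cols M)" by auto
    with assms[of M] cols_dim[of M] show "v \<in> carrier_vec n" by auto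
  qed
  then show "set (cols (block_row n Ms)) = (\<Union>M\<in>set Ms. set (cols M))"
    unfolding block_row_def by (subst cols_mat_of_cols) auto
qed

lemma same_zero_pattern_block_row:
  assumes "A \<in> carrier_mat n n" "B \<in> carrier_mat n n" "A' \<in> carrier_mat n n" "B' \<in> carrier_mat n n"
  shows "same_zero_pattern (block_row n [A', B']) (block_row n [A, B]) \<longleftrightarrow>
    (\<forall>i<n. \<forall>j<n. (A' $$ (i, j) = 0 \<longleftrightarrow> A $$ (i, j) = 0) \<and> (B' $$ (i, j) = 0 \<longleftrightarrow> B $$ (i, j) = 0))"
proof -
  have entry: "block_row n [M, N] $$ (i, j) = (if j < n then M $$ (i, j) else N $$ (i, j - n))"
    if "M \<in> carrier_mat n n" "N \<in> carrier_mat n n" "i < n" "j < n + n" for M N i j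
    using that by (auto simp: block_row_def mat_of_cols_index nth_append)
  have carr: "block_row n [M, N] \<in> carrier_mat n (n + n)"
    if "M \<in> carrier_mat n n" "N \<in> carrier_mat n n" for M N
    using block_row_carrier_cols(1)[of "[M, N]" n] that by auto
  show ?thesis (is "?L \<longleftrightarrow> ?R")
  proof
    assume L: ?L
    have "(block_row n [A', B'] $$ (i, j) = 0) = (block_row n [A, B] $$ (i, j) = 0)"
      if "i < n" "j < n + n" for i j
      using L that carr[OF assms(3,4)] unfolding same_zero_pattern_def by auto
    note eq = this
    show ?R
    proof (intro allI impI)
      fix i j assume ij: "i < n" "j < n"
      then show "(A' $$ (i, j) = 0 \<longleftrightarrow> A $$ (i, j) = 0) \<and> (B' $$ (i, j) = 0 \<longleftrightarrow> B $$ (i, j) = 0)"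
        using eq[of i j] eq[of i "j + n"] by (simp add: entry assms)
    qed
  next
    assume ?R
    then show ?L
      unfolding same_zero_pattern_def using carr[OF assms(1,2)] carr[OF assms(3,4)] assms
      by (auto simp: entry)
  qed
qed

lemma controllable_iff:
  assumes A: "A \<in> carrier_mat n n" and B: "B \<in> carrier_mat n m"
  shows "controllable n A B \<longleftrightarrow>
    (\<forall>x\<in>carrier_vec n. (\<forall>k<n. \<forall>j<m. col (A ^\<^sub>m k * B) j \<bullet> x = 0) \<longrightarrow> x = 0\<^sub>v n)"
proof -
  let ?Ms = "map (\<lambda>i. (A ^\<^sub>m i) * B) [0..<n]"
  have dims: "A ^\<^sub>m k * B \<in> carrier_mat n m" for k by (rule mult_carrier_mat[OF pow_carrier_mat[OF A] B])
  have "set (cols (A ^\<^sub>m k * B)) = col (A ^\<^sub>m k * B) ` {..<m}" for k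
    using dims[of k] by (auto simp: cols_def atLeast0LessThan simp del: index_mult_mat)
  moreover have "set (cols (block_row n ?Ms)) = (\<Union>k<n. set (cols (A ^\<^sub>m k * B)))"
    by (subst block_row_carrier_cols(2)) (use A in auto)
  ultimately have "(\<forall>v\<in>set (cols (block_row n ?Ms)). v \<bullet> x = 0) \<longleftrightarrow>
      (\<forall>k<n. \<forall>j<m. col (A ^\<^sub>m k * B) j \<bullet> x = 0)" for x
    by simp (simp add: Ball_def)
  moreover have "block_row n ?Ms \<in> carrier_mat n (sum_list (map dim_col ?Ms))"
    by (rule block_row_carrier_cols(1)) (use A in auto)
  ultimately show ?thesis
    unfolding controllable_def by (simp only: rank_eq_dim_iff)
qed

lemma row_act_power_conv_mat:
  assumes A: "A \<in> carrier_mat n n" and x: "x \<in> carrier_vec n"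
    and a: "\<And>i j. i < n \<Longrightarrow> j < n \<Longrightarrow> A $$ (i, j) = a i j" and j: "j < n"
  shows "(row_act {..<n} a ^^ k) (($) x) j = col (A ^\<^sub>m k) j \<bullet> x"
  using j
proof (induction k arbitrary: j)
  case 0
  then show ?case using A x by simp
next
  case (Suc k)
  have Ak: "A ^\<^sub>m k \<in> carrier_mat n n" using A by simp
  have "(row_act {..<n} a ^^ Suc k) (($) x) j = (\<Sum>i<n. \<Sum>v<n. (A ^\<^sub>m k) $$ (v, i) * x $ v * A $$ (i, j))"
    unfolding row_act_power_Suc
  proof (rule sum.cong[OF refl])
    fix i assume "i \<in> {..<n}"
    then have i: "i < n" by simp
    have "col (A ^\<^sub>m k) i \<bullet> x = (\<Sum>v<n. (A ^\<^sub>m k) $$ (v, i) * x $ v)"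
      using A x i by (auto simp: scalar_prod_def atLeast0LessThan intro!: sum.cong)
    then show "(row_act {..<n} a ^^ k) (($) x) i * a i j
        = (\<Sum>v<n. (A ^\<^sub>m k) $$ (v, i) * x $ v * A $$ (i, j))"
      using Suc.IH[OF i] Suc.prems a[OF i] by (simp add: sum_distrib_right)
  qed
  also have "\<dots> = (\<Sum>v<n. (\<Sum>i<n. (A ^\<^sub>m k) $$ (v, i) * A $$ (i, j)) * x $ v)"
    by (subst sum.swap) (simp add: sum_distrib_right sum_distrib_left mult_ac)
  also have "\<dots> = col (A ^\<^sub>m Suc k) j \<bullet> x"
    using Ak A x Suc.prems by (simp add: scalar_prod_def atLeast0LessThan)
  finally show ?case .
qed

lemma col_mult_input_mat:
  assumes "M \<in> carrier_mat n n" "j < n"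
  shows "col (M * input_mat n T) j = (if j \<in> T then col M j else 0\<^sub>v n)"
proof (rule eq_vecI)
  have carr: "M * input_mat n T \<in> carrier_mat n n"
    using assms(1) by (rule mult_carrier_mat) (simp add: input_mat_def)
  show "dim_vec (col (M * input_mat n T) j) = dim_vec (if j \<in> T then col M j else 0\<^sub>v n)"
    using carr assms by auto
  fix i assume "i < dim_vec (if j \<in> T then col M j else 0\<^sub>v n)"
  then have i: "i < n" using assms by (auto split: if_splits)
  have "(M * input_mat n T) $$ (i, j) = (\<Sum>v<n. if v = j then of_bool (j \<in> T) * M $$ (i, j) else 0)"
    proof -
    have "(M * input_mat n T) $$ (i, j) = (\<Sum>v<n. M $$ (i, v) * (if v = j then of_bool (j \<in> T) else 0))"
      using i assms by (auto simp: input_mat_def mat_diag_def scalar_prod_def atLeast0LessThan intro!: sum.cong)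
    also have "\<dots> = (\<Sum>v<n. if v = j then of_bool (j \<in> T) * M $$ (i, j) else 0)"
      by (intro sum.cong) auto
    finally show ?thesis .
  qed
  then show "col (M * input_mat n T) j $ i = (if j \<in> T then col M j else 0\<^sub>v n) $ i"
    using i assms carr by (auto simp del: index_mult_mat(1))
qed

lemma controllable_if_detects:
  assumes T: "T \<subseteq> {..<n}" and det: "detects {..<n} a T"
  shows "controllable n (mat n n (\<lambda>(i, j). a i j)) (input_mat n T)"
proof -
  let ?A = "mat n n (\<lambda>(i, j). a i j)"
  have A: "?A \<in> carrier_mat n n" by simp
  have B: "input_mat n T \<in> carrier_mat n n" by (simp add: input_mat_def)
  show ?thesis
    unfolding controllable_iff[OF A B]
  proof (intro ballI impI)
    fix x :: "real vec"
    assume x: "x \<in> carrier_vec n"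
      and ann: "\<forall>k<n. \<forall>j<n. col (?A ^\<^sub>m k * input_mat n T) j \<bullet> x = 0"
    have "(row_act {..<n} a ^^ k) (($) x) t = 0" if "k < n" "t \<in> T" for k t
    proof -
      have t: "t < n" using that T by auto
      have Ak: "?A ^\<^sub>m k \<in> carrier_mat n n" by simp
      have "col (?A ^\<^sub>m k) t \<bullet> x = 0"
        using ann that t col_mult_input_mat[OF Ak t, of T] by metis
      then show ?thesis by (subst row_act_power_conv_mat[OF A x _ t]) auto
    qed
    then have "x $ i = 0" if "i < n" for i
      using detects_finite_horizon[OF _ T det, of "($) x" i] that by simp
    then show "x = 0\<^sub>v n" using x by auto
  qed
qed

text \<open>
  Full row rank of \<open>[A B]\<close>, the part of the Popov-Belevitch-Hautus condition at the eigenvalue 0: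
  a row vector annihilated by \<open>A\<close> and \<open>B\<close> is annihilated by every \<open>A\<^sup>k B\<close>.
\<close>
lemma controllable_imp_independent_rows:
  assumes A: "A \<in> carrier_mat n n" and B: "B \<in> carrier_mat n m" and ctrl: "controllable n A B"
    and x: "x \<in> carrier_vec n" and xA: "\<And>j. j < n \<Longrightarrow> col A j \<bullet> x = 0"
    and xB: "\<And>j. j < m \<Longrightarrow> col B j \<bullet> x = 0"
  shows "x = 0\<^sub>v n"
proof -
  have "col (A ^\<^sub>m k * B) j \<bullet> x = 0" if j: "j < m" for k j
  proof (cases k)
    case 0
    then show ?thesis using xB[OF j] A B by simp
  next
    case (Suc l)
    define N where "N = A ^\<^sub>m l * B"
    have N: "N \<in> carrier_mat n m"
      unfolding N_def by (rule mult_carrier_mat[OF pow_carrier_mat[OF A] B])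
    have "A ^\<^sub>m k = A * A ^\<^sub>m l"
      unfolding Suc
    proof (induction l)
      case (Suc l)
      have "A ^\<^sub>m Suc (Suc l) = (A * A ^\<^sub>m l) * A" using Suc.IH by simp
      also have "\<dots> = A * A ^\<^sub>m Suc l" using A by (simp add: assoc_mult_mat[of A n n _ n _ n])
      finally show ?case .
    qed (use A in simp)
    then have eq: "A ^\<^sub>m k * B = A * N"
      using A B by (simp add: N_def assoc_mult_mat[of A n n _ n _ m])
    have "col (A * N) j \<bullet> x = (\<Sum>v<n. \<Sum>i<n. A $$ (v, i) * N $$ (i, j) * x $ v)"
      using A N x j by (simp add: scalar_prod_def atLeast0LessThan sum_distrib_right)
    also have "\<dots> = (\<Sum>i<n. N $$ (i, j) * (col A i \<bullet> x))"
      using A x by (subst sum.swap) (simp add: scalar_prod_def atLeast0LessThan sum_distrib_left mult_ac)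
    also have "\<dots> = 0" using xA by simp
    finally show ?thesis by (simp add: eq)
  qed
  with ctrl x show ?thesis unfolding controllable_iff[OF A B] by blast
qed

section \<open>Structural controllability over a strongly connected graph\<close>

lemma strongly_connected_edge_leaving:
  assumes sc: "strongly_connected (with_proj (digraph_of A))" and A: "A \<in> carrier_mat n n"
    and D: "D \<subset> {..<n}" "D \<noteq> {}"
  shows "\<exists>u\<in>D. \<exists>w\<in>{..<n} - D. A $$ (w, u) \<noteq> 0"
proof (rule ccontr)
  assume neg: "\<not> ?thesis"
  have verts: "pverts (digraph_of A) = {..<n}" using A by (simp add: digraph_of_def)
  obtain u v where uv: "u \<in> D" "v \<in> {..<n} - D" using D by blast
  have "reachable (with_proj (digraph_of A)) u v"
    using sc uv D unfolding strongly_connected_def by (auto simp: verts)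
  then have "(u, v) \<in> rtrancl_on {..<n} (parcs (digraph_of A))"
    unfolding reachable_def by (simp add: verts)
  then have "v \<in> D"
  proof (induction rule: rtrancl_on_induct)
    case (step y z)
    then show ?case using neg A by (auto simp: digraph_of_def)
  qed (use uv in auto)
  with uv show False by blast
qed

text \<open>
  Lin's theorem for strongly connected graphs with dedicated inputs: reachability from \<open>T\<close> is
  automatic, and what remains is the absence of dilations, that is, each vertex without input can be
  given a private in-neighbour \<open>p i\<close>.  For necessity, a matrix \<open>A'\<close> with the pattern of \<open>A\<close>
  has independent rows outside \<open>T\<close>, since the input columns vanish there.
\<close>
theorem structurally_controllable_iff:
  assumes A: "A \<in> carrier_mat n n" and sc: "strongly_connected (with_proj (digraph_of A))"
    and T: "T \<subseteq> {..<n}" "T \<noteq> {}"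
  shows "structurally_controllable n A (input_mat n T) \<longleftrightarrow>
    (\<exists>p. inj_on p ({..<n} - T) \<and> (\<forall>i\<in>{..<n} - T. p i < n \<and> A $$ (i, p i) \<noteq> 0))"
proof
  have B: "input_mat n T \<in> carrier_mat n n" by (simp add: input_mat_def)
  {
    assume "structurally_controllable n A (input_mat n T)"
    then obtain A' B' where A': "A' \<in> carrier_mat n n" and B': "B' \<in> carrier_mat n n"
      and ctrl: "controllable n A' B'"
      and pat: "\<And>i j. i < n \<Longrightarrow> j < n \<Longrightarrow> A' $$ (i, j) = 0 \<longleftrightarrow> A $$ (i, j) = 0"
        "\<And>i j. i < n \<Longrightarrow> j < n \<Longrightarrow> B' $$ (i, j) = 0 \<longleftrightarrow> input_mat n T $$ (i, j) = 0"
      unfolding structurally_controllable_def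
      by (auto simp: same_zero_pattern_block_row[OF A B])
    have "\<exists>p. inj_on p ({..<n} - T) \<and> (\<forall>i\<in>{..<n} - T. p i \<in> {..<n} \<and> A' $$ (i, p i) \<noteq> 0)"
    proof (rule independent_rows_choose_nonzero_entries)
      fix x :: "nat \<Rightarrow> real"
      assume x: "\<And>j. j \<in> {..<n} \<Longrightarrow> (\<Sum>i\<in>{..<n} - T. x i * A' $$ (i, j)) = 0"
      define y where "y = vec n (\<lambda>i. if i \<in> T then 0 else x i)"
      have "y = 0\<^sub>v n"
      proof (rule controllable_imp_independent_rows[OF A' B' ctrl])
        show "col A' j \<bullet> y = 0" if "j < n" for j
        proof -
          have "col A' j \<bullet> y = (\<Sum>i<n. if i \<in> T then 0 else x i * A' $$ (i, j))"
            using that A' by (auto simp: y_def scalar_prod_def atLeast0LessThan intro!: sum.cong)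
          also have "\<dots> = (\<Sum>i\<in>{..<n} - T. x i * A' $$ (i, j))"
            by (intro sum.mono_neutral_cong_right) auto
          finally show ?thesis using x that by simp
        qed
        show "col B' j \<bullet> y = 0" if "j < n" for j
        proof -
          have "B' $$ (i, j) * y $ i = 0" if "i < n" for i
            using pat(2)[OF that \<open>j < n\<close>] that \<open>j < n\<close>
            by (auto simp: y_def input_mat_def mat_diag_def)
          then have "(\<Sum>i<n. B' $$ (i, j) * y $ i) = 0" by (intro sum.neutral) auto
          then show ?thesis using B' that by (simp add: scalar_prod_def y_def atLeast0LessThan)
        qed
      qed (simp add: y_def)
      then show "\<forall>i\<in>{..<n} - T. x i = 0"
        by (auto simp: y_def vec_eq_iff)
    qed auto
    then show "\<exists>p. inj_on p ({..<n} - T) \<and> (\<forall>i\<in>{..<n} - T. p i < n \<and> A $$ (i, p i) \<noteq> 0)"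
      using pat(1) by (metis DiffD1 lessThan_iff)
  }
  {
    assume "\<exists>p. inj_on p ({..<n} - T) \<and> (\<forall>i\<in>{..<n} - T. p i < n \<and> A $$ (i, p i) \<noteq> 0)"
    then obtain p where p: "inj_on p ({..<n} - T)"
      "\<And>i. i \<in> {..<n} - T \<Longrightarrow> p i \<in> {..<n} \<and> A $$ (i, p i) \<noteq> 0" by auto
    obtain a where a: "detects {..<n} a T"
      "\<forall>i\<in>{..<n}. \<forall>j\<in>{..<n}. a i j \<noteq> 0 \<longrightarrow> A $$ (i, j) \<noteq> 0"
      using exists_detecting_weights[where edge = "\<lambda>i j. A $$ (i, j) \<noteq> 0",
          OF finite_lessThan T p strongly_connected_edge_leaving[OF sc A]] by blast
    obtain a' where a': "detects {..<n} a' T"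
      "\<forall>i<n. \<forall>j<n. a' i j = 0 \<longleftrightarrow> A $$ (i, j) = 0"
      using detects_perturb_to_full_support[OF T(1) a(1), of "\<lambda>i j. A $$ (i, j)"] a(2) by auto
    let ?A = "mat n n (\<lambda>(i, j). a' i j)"
    have "controllable n ?A (input_mat n T)" by (rule controllable_if_detects[OF T(1) a'(1)])
    moreover have "same_zero_pattern (block_row n [?A, input_mat n T]) (block_row n [A, input_mat n T])"
      using a'(2) by (subst same_zero_pattern_block_row[OF A B _ B]) auto
    ultimately show "structurally_controllable n A (input_mat n T)"
      unfolding structurally_controllable_def using B by (meson mat_carrier)
  }
qed

section \<open>Matchings in the auxiliary bipartite graph\<close>

lemma aux_bigraph_edges:
  assumes "A \<in> carrier_mat n n"
  shows "bedges (aux_bigraph A S) =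
    {{Orig i, Copy1 j} |i j. i < n \<and> j < n \<and> A $$ (j, i) \<noteq> 0} \<union> {{Copy2 k, Copy1 k} |k. k \<in> S}"
  using assms by (auto simp: aux_bigraph_def digraph_of_def)

lemma matching_edge_cases:
  assumes "A \<in> carrier_mat n n" "matching (aux_bigraph A S) M" "e \<in> M"
  obtains (state) i j where "i < n" "j < n" "A $$ (j, i) \<noteq> 0" "e = {Orig i, Copy1 j}"
    | (input) k where "k \<in> S" "e = {Copy2 k, Copy1 k}"
proof -
  have "e \<in> bedges (aux_bigraph A S)" using assms(2,3) by (auto simp: matching_def)
  then show thesis unfolding aux_bigraph_edges[OF assms(1)] using that by blast
qed

text \<open>
  Each edge of the graph contains exactly one vertex of the form \<open>Copy1 j\<close>, so a matching is
  measured by the indices that it covers on this side.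
\<close>
definition covered :: "bvertex set set \<Rightarrow> nat set" where
  "covered M = {j. Copy1 j \<in> \<Union>M}"

lemma card_matching_eq_card_covered:
  assumes A: "A \<in> carrier_mat n n" and S: "S \<subseteq> {..<n}" and M: "matching (aux_bigraph A S) M"
  shows "covered M \<subseteq> {..<n}" and "card M = card (covered M)"
proof -
  have edge: "\<exists>j<n. e \<inter> range Copy1 = {Copy1 j}" if "e \<in> M" for e
    using A M that
  proof (cases rule: matching_edge_cases)
    case (input k)
    then show ?thesis using S by (intro exI[of _ k]) auto
  qed auto
  then obtain h where h: "\<And>e. e \<in> M \<Longrightarrow> h e < n \<and> e \<inter> range Copy1 = {Copy1 (h e)}" by metis
  have cov: "covered M = h ` M"
  proof
    show "covered M \<subseteq> h ` M"
    proof
      fix j assume "j \<in> covered M"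
      then obtain e where "e \<in> M" "Copy1 j \<in> e" by (auto simp: covered_def)
      with h[of e] have "j = h e" by auto
      with \<open>e \<in> M\<close> show "j \<in> h ` M" by blast
    qed
    show "h ` M \<subseteq> covered M"
    proof
      fix j assume "j \<in> h ` M"
      then obtain e where e: "e \<in> M" "j = h e" by blast
      with h[OF e(1)] have "Copy1 j \<in> e" by blast
      with e(1) show "j \<in> covered M" by (auto simp: covered_def)
    qed
  qed
  then show "covered M \<subseteq> {..<n}" using h by auto
  have "inj_on h M"
  proof (rule inj_onI, rule ccontr)
    fix e f assume ef: "e \<in> M" "f \<in> M" "h e = h f" "e \<noteq> f"
    then have "e \<inter> f = {}" using M by (auto simp: matching_def)
    with h[OF ef(1)] h[OF ef(2)] ef(3) show False by auto
  qed
  then show "card M = card (covered M)" by (simp add: cov card_image)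
qed

lemma matching_choose_sources:
  assumes A: "A \<in> carrier_mat n n" and M: "matching (aux_bigraph A S) M"
    and V: "V \<subseteq> covered M - S"
  shows "\<exists>p. inj_on p V \<and> (\<forall>i\<in>V. p i < n \<and> A $$ (i, p i) \<noteq> 0)"
proof -
  have "\<exists>j. {Orig j, Copy1 i} \<in> M \<and> j < n \<and> A $$ (i, j) \<noteq> 0" if i: "i \<in> V" for i
  proof -
    obtain e where e: "e \<in> M" "Copy1 i \<in> e" using V i by (auto simp: covered_def)
    from A M e(1) show ?thesis
      by (cases rule: matching_edge_cases) (use e V i in auto)
  qed
  then obtain p where p: "\<And>i. i \<in> V \<Longrightarrow> {Orig (p i), Copy1 i} \<in> M \<and> p i < n \<and> A $$ (i, p i) \<noteq> 0"
    by metis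
  have "inj_on p V"
  proof (rule inj_onI, rule ccontr)
    fix i j assume ij: "i \<in> V" "j \<in> V" "p i = p j" "i \<noteq> j"
    have "{Orig (p i), Copy1 i} \<noteq> {Orig (p j), Copy1 j}" using ij by (auto simp: doubleton_eq_iff)
    moreover have "{Orig (p i), Copy1 i} \<in> M" "{Orig (p j), Copy1 j} \<in> M"
      using p ij(1,2) by blast+
    ultimately have "{Orig (p i), Copy1 i} \<inter> {Orig (p j), Copy1 j} = {}"
      using M unfolding matching_def by metis
    with ij(3) show False by auto
  qed
  with p show ?thesis by blast
qed

lemma matching_of_sources:
  assumes A: "A \<in> carrier_mat n n" and S: "S \<subseteq> {..<n}" and V: "V \<subseteq> {..<n} - S"
    and p: "inj_on p V" "\<And>i. i \<in> V \<Longrightarrow> p i < n \<and> A $$ (i, p i) \<noteq> 0"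
  shows "\<exists>M. matching (aux_bigraph A S) M \<and> card M = card V + card S"
proof -
  define M where "M = (\<lambda>i. {Orig (p i), Copy1 i}) ` V \<union> (\<lambda>k. {Copy2 k, Copy1 k}) ` S"
  have match: "matching (aux_bigraph A S) M"
    unfolding matching_def
  proof
    show "M \<subseteq> bedges (aux_bigraph A S)"
    proof
      fix e assume "e \<in> M"
      then consider i where "i \<in> V" "e = {Orig (p i), Copy1 i}" | k where "k \<in> S" "e = {Copy2 k, Copy1 k}"
        by (auto simp: M_def)
      then show "e \<in> bedges (aux_bigraph A S)"
      proof cases
        case 1
        then have "p i < n" "i < n" "A $$ (i, p i) \<noteq> 0" using p(2) V by auto
        with 1(2) show ?thesis unfolding aux_bigraph_edges[OF A] by blast
      qed (auto simp: aux_bigraph_edges[OF A])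
    qed
    show "\<forall>e\<in>M. \<forall>f\<in>M. e \<noteq> f \<longrightarrow> e \<inter> f = {}"
      using V unfolding M_def by (auto simp: ball_Un inj_on_eq_iff[OF p(1)])
  qed
  have "covered M = V \<union> S" by (auto simp: covered_def M_def)
  moreover have "finite V" "finite S" using S V by (auto intro: finite_subset)
  then have "card (V \<union> S) = card V + card S" using V by (intro card_Un_disjoint) auto
  ultimately show ?thesis using match card_matching_eq_card_covered(2)[OF A S match] by auto
qed

theorem proposition7:
  fixes A :: "real mat" and n K k :: nat and S :: "nat set" and m :: "bvertex set set"
  assumes "n \<ge> 1"
    and "A \<in> carrier_mat n n"
    and "strongly_connected (with_proj (digraph_of A))"
    and "1 \<le> K" and "K \<le> n"
    and "S \<subseteq> {..<n}" and "card S = k" and "k \<le> K"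
    and "maximum_matching (aux_bigraph A S) m"
  shows "S \<in> extendable_sets A K \<longleftrightarrow> card m \<ge> n - K + k"
proof -
  note A = assms(2) and S = assms(6)
  have m: "matching (aux_bigraph A S) m"
    and max: "\<And>M. matching (aux_bigraph A S) M \<Longrightarrow> card M \<le> card m"
    using assms(9) by (auto simp: maximum_matching_def)
  define sourced where "sourced T \<longleftrightarrow>
    (\<exists>p. inj_on p ({..<n} - T) \<and> (\<forall>i\<in>{..<n} - T. p i < n \<and> A $$ (i, p i) \<noteq> 0))" for T
  have ext: "S \<in> extendable_sets A K \<longleftrightarrow> (\<exists>T. S \<subseteq> T \<and> T \<subseteq> {..<n} \<and> card T = K \<and> sourced T)"
  proof -
    have "structurally_controllable n A (input_mat n T) \<longleftrightarrow> sourced T"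
      if "T \<subseteq> {..<n}" "card T = K" for T
      unfolding sourced_def
      using that assms(4) by (intro structurally_controllable_iff[OF A assms(3)]) auto
    moreover have "dim_row A = n" using A by simp
    ultimately show ?thesis unfolding extendable_sets_def control_sets_def by auto
  qed
  show ?thesis
  proof
    assume "S \<in> extendable_sets A K"
    then obtain T where T: "S \<subseteq> T" "T \<subseteq> {..<n}" "card T = K" and "sourced T"
      using ext by blast
    then obtain p where p: "inj_on p ({..<n} - T)" "\<forall>i\<in>{..<n} - T. p i < n \<and> A $$ (i, p i) \<noteq> 0"
      unfolding sourced_def by blast
    have "{..<n} - T \<subseteq> {..<n} - S" using T(1) by blast
    from matching_of_sources[OF A S this p(1)] p(2)
    obtain M where "matching (aux_bigraph A S) M" "card M = card ({..<n} - T) + card S" by auto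
    moreover have "card ({..<n} - T) = n - K"
      using T by (simp add: card_Diff_subset finite_subset[OF T(2)])
    ultimately show "card m \<ge> n - K + k" using max assms(7) by metis
  next
    assume card: "card m \<ge> n - K + k"
    \<comment> \<open>the vertices without a matching edge receive inputs themselves\<close>
    define U where "U = {..<n} - covered m"
    note cov = card_matching_eq_card_covered[OF A S m]
    have "card U = n - card m"
      using cov by (simp add: U_def card_Diff_subset finite_subset[OF cov(1)])
    then have cardU: "card U \<le> K - k" using card assms(5,8) by linarith
    have "card (S \<union> U) \<le> K" using card_Un_le[of S U] cardU assms(7,8) by linarith
    moreover have SU: "S \<union> U \<subseteq> {..<n}" using S by (auto simp: U_def)
    ultimately obtain T where T: "S \<union> U \<subseteq> T" "T \<subseteq> {..<n}" "card T = K"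
      using exists_subset_between[of "S \<union> U" K "{..<n}"] assms(5) by auto
    have "{..<n} - T \<subseteq> covered m - S" using T(1) by (auto simp: U_def)
    from matching_choose_sources[OF A m this] have "sourced T" by (simp only: sourced_def)
    with T show "S \<in> extendable_sets A K" using ext by blast
  qed
qed

end
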